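(* Let $k\ge 1$ and $m\ge 1$ be integers. For any tree $T$ of order $m$, every $k$-edge-connected cograph $G$ with $\delta(G)\ge \max\{k+\Delta(T)+\beta(T)-1,\; m-1\}$ contains a subtree $T'\cong T$ such that $G-E(T')$ is $k$-edge-connected.
   Context: Graphs are finite, simple and undirected. The order of a graph is its number of vertices; $\delta(G)$ is the minimum degree and $\Delta(G)$ the maximum degree. For a nontrivial tree $T$ (order at least 2) with bipartition $(V_1,V_2)$ (the partition of $V(T)$ into two sets such that every edge joins $V_1$ to $V_2$), $\beta(T)=\min\{|V_1|,|V_2|\}$; for the tree of order 1, set $\beta(T)=0$. Cographs are defined recursively: $K_1$ is a cograph; the disjoint union of cographs is a cograph; the join of cographs is a cograph, where the join $G_1+G_2$ of vertex-disjoint graphs is obtained from their disjoint union by adding all edges between $V(G_1)$ and $V(G_2)$. (Equivalently, cographs are the graphs with no induced path $P_4$ on four vertices.) The edge-connectivity $\lambda(G)$ is the minimum number of edges whose removal from $G$ results in a disconnected graph or a trivial graph (a graph of order 1); in particular $\lambda(K_1)=0$. $G$ is $k$-edge-connected if $\lambda(G)\ge k$, with the additional convention that $K_1$ is regarded as 1-edge-connected. For $F\subseteq E(G)$, $G-F$ is the graph obtained by deleting all edges of $F$ (keeping all vertices). A subtree of $G$ is a (not necessarily induced) subgraph that is a tree. *)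

theory Defs
  imports Main
begin

record 'a ugraph =
  vertices :: "'a set"
  edges :: "'a set set"

definition simple_graph :: "'a ugraph \<Rightarrow> bool" where
  "simple_graph G \<longleftrightarrow> finite (vertices G) \<and> (\<forall>e\<in>edges G. e \<subseteq> vertices G \<and> card e = 2)"

definition graph_order :: "'a ugraph \<Rightarrow> nat" where
  "graph_order G = card (vertices G)"

definition degree :: "'a ugraph \<Rightarrow> 'a \<Rightarrow> nat" where
  "degree G v = card {e \<in> edges G. v \<in> e}"

definition min_degree :: "'a ugraph \<Rightarrow> nat" where
  "min_degree G = Min (degree G ` vertices G)"

definition max_degree :: "'a ugraph \<Rightarrow> nat" where
  "max_degree G = Max (degree G ` vertices G)"

definition adjacency :: "'a ugraph \<Rightarrow> 'a rel" where
  "adjacency G = {(u, v). {u, v} \<in> edges G}"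

definition connected_graph :: "'a ugraph \<Rightarrow> bool" where
  "connected_graph G \<longleftrightarrow> vertices G \<noteq> {} \<and>
     (\<forall>u\<in>vertices G. \<forall>v\<in>vertices G. (u, v) \<in> (adjacency G)\<^sup>*)"

definition graph_cycle :: "'a ugraph \<Rightarrow> 'a list \<Rightarrow> bool" where
  "graph_cycle G c \<longleftrightarrow> 3 \<le> length c \<and> distinct c \<and>
     (\<forall>i<length c. {c ! i, c ! (Suc i mod length c)} \<in> edges G)"

definition tree :: "'a ugraph \<Rightarrow> bool" where
  "tree T \<longleftrightarrow> simple_graph T \<and> connected_graph T \<and> (\<nexists>c. graph_cycle T c)"

definition subgraph :: "'a ugraph \<Rightarrow> 'a ugraph \<Rightarrow> bool" where
  "subgraph H G \<longleftrightarrow> simple_graph H \<and> vertices H \<subseteq> vertices G \<and> edges H \<subseteq> edges G"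

definition subtree :: "'a ugraph \<Rightarrow> 'a ugraph \<Rightarrow> bool" where
  "subtree T G \<longleftrightarrow> subgraph T G \<and> tree T"

definition graph_iso :: "'a ugraph \<Rightarrow> 'b ugraph \<Rightarrow> bool" where
  "graph_iso G H \<longleftrightarrow> (\<exists>f. bij_betw f (vertices G) (vertices H) \<and>
     (\<forall>u\<in>vertices G. \<forall>v\<in>vertices G. {u, v} \<in> edges G \<longleftrightarrow> {f u, f v} \<in> edges H))"

definition bipartition :: "'a ugraph \<Rightarrow> 'a set \<Rightarrow> 'a set \<Rightarrow> bool" where
  "bipartition G V1 V2 \<longleftrightarrow> V1 \<union> V2 = vertices G \<and> V1 \<inter> V2 = {} \<and>
     (\<forall>e\<in>edges G. \<exists>u\<in>V1. \<exists>v\<in>V2. e = {u, v})"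

text \<open>A tree has exactly one bipartition up to exchanging the two classes, so the
  description below is proper whenever \<open>T\<close> is a nontrivial tree.\<close>

definition tree_beta :: "'a ugraph \<Rightarrow> nat" where
  "tree_beta T = (if graph_order T = 1 then 0
     else THE b. \<exists>V1 V2. bipartition T V1 V2 \<and> b = min (card V1) (card V2))"

definition single_vertex :: "'a \<Rightarrow> 'a ugraph" where
  "single_vertex v = \<lparr>vertices = {v}, edges = {}\<rparr>"

definition graph_union :: "'a ugraph \<Rightarrow> 'a ugraph \<Rightarrow> 'a ugraph" where
  "graph_union G H = \<lparr>vertices = vertices G \<union> vertices H, edges = edges G \<union> edges H\<rparr>"

definition graph_join :: "'a ugraph \<Rightarrow> 'a ugraph \<Rightarrow> 'a ugraph" where
  "graph_join G H = \<lparr>vertices = vertices G \<union> vertices H,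
     edges = edges G \<union> edges H \<union> {{u, v} |u v. u \<in> vertices G \<and> v \<in> vertices H}\<rparr>"

inductive cograph :: "'a ugraph \<Rightarrow> bool" where
  cograph_single: "cograph (single_vertex v)"
| cograph_union: "cograph G \<Longrightarrow> cograph H \<Longrightarrow> vertices G \<inter> vertices H = {}
    \<Longrightarrow> cograph (graph_union G H)"
| cograph_join: "cograph G \<Longrightarrow> cograph H \<Longrightarrow> vertices G \<inter> vertices H = {}
    \<Longrightarrow> cograph (graph_join G H)"

lemma cograph_simple_graph: "cograph G \<Longrightarrow> simple_graph G"
proof (induction rule: cograph.induct)
  case (cograph_single v)
  then show ?case by (simp add: simple_graph_def single_vertex_def)
next
  case (cograph_union G H)
  then show ?case by (auto simp: simple_graph_def graph_union_def)
next
  case (cograph_join G H)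
  then show ?case
    by (auto simp: simple_graph_def graph_join_def card_2_iff disjoint_iff; metis)
qed

lemma cograph_nonempty: "cograph G \<Longrightarrow> vertices G \<noteq> {}"
  by (induction rule: cograph.induct) (auto simp: single_vertex_def graph_union_def graph_join_def)

definition delete_edges :: "'a ugraph \<Rightarrow> 'a set set \<Rightarrow> 'a ugraph" where
  "delete_edges G F = \<lparr>vertices = vertices G, edges = edges G - F\<rparr>"

definition edge_connectivity :: "'a ugraph \<Rightarrow> nat" where
  "edge_connectivity G = (LEAST n. \<exists>F\<subseteq>edges G. card F = n \<and>
     (\<not> connected_graph (delete_edges G F) \<or> graph_order (delete_edges G F) = 1))"

text \<open>The edge-connectivity of a graph with one vertex is 0, but such a graph
  counts as 1-edge-connected by convention.\<close>

definition k_edge_connected :: "nat \<Rightarrow> 'a ugraph \<Rightarrow> bool" where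
  "k_edge_connected k G \<longleftrightarrow> k \<le> edge_connectivity G \<or> (k = 1 \<and> graph_order G = 1)"

end

(* A connected cograph with more than one vertex is a join of two nonempty parts A and B. Let V1 be
   a smaller colour class of T, of size beta(T). Since the minimum degree of G is at least m - 1, a
   greedy embedding of T can be started from any prescribed copy of a small subtree, and this freedom
   is used to keep a vertex of A and a vertex of B out of the image W of V1. Then G - W still is a
   join, hence of diameter at most 2, and it keeps all its edges when E(T') is removed, because every
   edge of T' meets W. In G - E(T') every vertex has at least k neighbours outside W: a vertex outside
   W loses at most beta(T) neighbours, one in W at most Delta(T) + beta(T) - 1. Every cut is then at
   least as large as some vertex's number of neighbours outside W, as in the proof that graphs of
   diameter 2 have edge-connectivity equal to their minimum degree. *)

theory Submission
  imports Defs
begin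

section \<open>Neighbourhoods, degrees and edges leaving a vertex set\<close>

lemma simple_graphD:
  assumes "simple_graph G"
  shows "finite (vertices G)" and "finite (edges G)"
    and "{u, v} \<in> edges G \<Longrightarrow> u \<in> vertices G \<and> v \<in> vertices G \<and> u \<noteq> v"
    and "e \<in> edges G \<Longrightarrow> \<exists>u v. e = {u, v} \<and> u \<noteq> v"
proof -
  show 1: "finite (vertices G)" using assms by (simp add: simple_graph_def)
  have "edges G \<subseteq> Pow (vertices G)" using assms by (auto simp: simple_graph_def)
  then show "finite (edges G)" using 1 finite_subset by blast
  show "{u, v} \<in> edges G \<Longrightarrow> u \<in> vertices G \<and> v \<in> vertices G \<and> u \<noteq> v"
    using assms by (force simp: simple_graph_def)
  show "e \<in> edges G \<Longrightarrow> \<exists>u v. e = {u, v} \<and> u \<noteq> v"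
    using assms by (auto simp: simple_graph_def card_2_iff)
qed

definition neighbours :: "'a ugraph \<Rightarrow> 'a \<Rightarrow> 'a set" where
  "neighbours G v = {u. {v, u} \<in> edges G}"

lemma neighbours_subset: "simple_graph G \<Longrightarrow> neighbours G v \<subseteq> vertices G - {v}"
  by (auto simp: neighbours_def dest: simple_graphD(3))

lemma finite_neighbours: "simple_graph G \<Longrightarrow> finite (neighbours G v)"
  using neighbours_subset simple_graphD(1) by (metis finite_Diff finite_subset)

lemma card_neighbours:
  assumes "simple_graph G"
  shows "card (neighbours G v) = degree G v"
proof -
  have "bij_betw (\<lambda>u. {v, u}) (neighbours G v) {e \<in> edges G. v \<in> e}"
    unfolding bij_betw_def
  proof
    show "inj_on (\<lambda>u. {v, u}) (neighbours G v)"
      by (auto simp: inj_on_def doubleton_eq_iff)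
    show "(\<lambda>u. {v, u}) ` neighbours G v = {e \<in> edges G. v \<in> e}"
    proof (intro equalityI subsetI)
      fix e assume e: "e \<in> {e \<in> edges G. v \<in> e}"
      then obtain a b where "e = {a, b}" using simple_graphD(4)[OF assms] by blast
      then have "e = {v, a} \<or> e = {v, b}" using e by auto
      then show "e \<in> (\<lambda>u. {v, u}) ` neighbours G v" using e by (auto simp: neighbours_def)
    qed (auto simp: neighbours_def)
  qed
  then show ?thesis by (simp add: bij_betw_same_card degree_def)
qed

lemma min_degree_le:
  assumes "simple_graph G" and "v \<in> vertices G"
  shows "min_degree G \<le> card (neighbours G v)"
  using assms by (simp add: card_neighbours min_degree_def simple_graphD(1))

lemma max_degree_ge:
  assumes "simple_graph G" and "v \<in> vertices G"
  shows "card (neighbours G v) \<le> max_degree G"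
  using assms by (simp add: card_neighbours max_degree_def simple_graphD(1))

lemma min_degree_less_order:
  assumes "simple_graph G" and "v \<in> vertices G"
  shows "min_degree G < card (vertices G)"
proof -
  have "card (neighbours G v) \<le> card (vertices G - {v})"
    using neighbours_subset[OF assms(1)] simple_graphD(1)[OF assms(1)] by (simp add: card_mono)
  also have "\<dots> < card (vertices G)"
    using assms simple_graphD(1) by (metis card_Diff1_less)
  finally show ?thesis using min_degree_le[OF assms] by simp
qed

text \<open>A walk from \<open>S\<close> to a vertex outside has to leave \<open>S\<close>
  somewhere. This is the form in which connectedness of a graph is used from here on.\<close>

lemma boundary_edge:
  assumes "simple_graph G" and "connected_graph G"
    and "S \<subseteq> vertices G" and "S \<noteq> {}" and "S \<noteq> vertices G"
  obtains x y where "x \<in> S" and "y \<in> vertices G - S" and "{x, y} \<in> edges G"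
proof -
  obtain u v where u: "u \<in> S" and v: "v \<in> vertices G - S" using assms(3-5) by blast
  have "(u, v) \<in> (adjacency G)\<^sup>*" using assms(2,3) u v by (auto simp: connected_graph_def)
  then have "v \<in> S \<or> (\<exists>x y. x \<in> S \<and> y \<notin> S \<and> {x, y} \<in> edges G)"
    by (induction rule: rtrancl_induct) (use u in \<open>auto simp: adjacency_def\<close>)
  then obtain x y where "x \<in> S" "y \<notin> S" "{x, y} \<in> edges G" using v by blast
  then show thesis using that simple_graphD(3)[OF assms(1)] by blast
qed


subsection \<open>Growing a tree vertex by vertex\<close>

text \<open>Walks must stay inside \<open>S\<close>, so that a vertex outside \<open>S\<close> with
  two neighbours in \<open>S\<close> closes such a walk into a genuine cycle.\<close>

definition connected_on :: "'a ugraph \<Rightarrow> 'a set \<Rightarrow> bool" where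
  "connected_on G S \<longleftrightarrow> (\<forall>u\<in>S. \<forall>v\<in>S. (u, v) \<in> (adjacency G \<inter> S \<times> S)\<^sup>*)"

lemma connected_on_insert:
  assumes "connected_on G S" and "x \<in> S" and "{x, y} \<in> edges G"
  shows "connected_on G (insert y S)"
proof -
  let ?R = "adjacency G \<inter> insert y S \<times> insert y S"
  have "(adjacency G \<inter> S \<times> S)\<^sup>* \<subseteq> ?R\<^sup>*" by (intro rtrancl_mono) auto
  then have S: "(u, v) \<in> ?R\<^sup>*" if "u \<in> S" "v \<in> S" for u v
    using assms(1) that by (auto simp: connected_on_def)
  have xy: "(x, y) \<in> ?R" "(y, x) \<in> ?R"
    using assms(2,3) by (auto simp: adjacency_def insert_commute)
  have "(u, x) \<in> ?R\<^sup>*" "(x, u) \<in> ?R\<^sup>*" if "u \<in> insert y S" for u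
    using that S assms(2) xy by blast+
  then show ?thesis unfolding connected_on_def by (meson rtrancl_trans)
qed

text \<open>Build the path backwards from \<open>y\<close>. If the vertex to be prepended already
  occurs, the suffix starting at that occurrence is a path from it.\<close>

lemma rtrancl_distinct_path:
  assumes "(x, y) \<in> R\<^sup>*"
  shows "\<exists>xs. xs \<noteq> [] \<and> hd xs = x \<and> last xs = y \<and> distinct xs
    \<and> successively (\<lambda>a b. (a, b) \<in> R) xs"
  using assms
proof (induction rule: converse_rtrancl_induct)
  case base
  show ?case by (rule exI[of _ "[y]"]) simp
next
  case (step x z)
  then obtain xs where xs: "xs \<noteq> []" "hd xs = z" "last xs = y" "distinct xs"
    "successively (\<lambda>a b. (a, b) \<in> R) xs" by blast
  show ?case
  proof (cases "x \<in> set xs")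
    case True
    then obtain as bs where "xs = as @ x # bs" by (meson split_list)
    then show ?thesis using xs
      by (intro exI[of _ "x # bs"]) (auto simp: successively_append_iff)
  next
    case False
    then show ?thesis using xs step(1)
      by (intro exI[of _ "x # xs"]) (auto simp: successively_Cons)
  qed
qed

text \<open>Two different neighbours of \<open>y\<close> in \<open>S\<close>, joined by a path
  inside \<open>S\<close>, would give a cycle through \<open>y\<close>.\<close>

lemma tree_unique_attachment:
  assumes "tree T" and "connected_on T S" and "y \<notin> S"
    and "x \<in> S" "{x, y} \<in> edges T" and "z \<in> S" "{z, y} \<in> edges T"
  shows "z = x"
proof (rule ccontr)
  assume "z \<noteq> x"
  let ?R = "adjacency T \<inter> S \<times> S"
  have "(x, z) \<in> ?R\<^sup>*" using assms by (auto simp: connected_on_def)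
  then obtain xs where xs: "xs \<noteq> []" "hd xs = x" "last xs = z" "distinct xs"
    "successively (\<lambda>a b. (a, b) \<in> ?R) xs"
    using rtrancl_distinct_path by metis
  have step: "(xs ! i, xs ! Suc i) \<in> ?R" if "Suc i < length xs" for i
    using xs(5) that by (simp add: successively_conv_nth)
  \<comment> \<open>Since \<open>z\<close> differs from \<open>x\<close>, the path has at least two
    vertices; together with \<open>y\<close> this gives the length 3 that a cycle requires.\<close>
  obtain a b ys where abys: "xs = a # b # ys"
    using xs(1-3) \<open>z \<noteq> x\<close> by (metis last.simps list.exhaust list.sel(1))
  have len: "2 \<le> length xs" using abys by simp
  have sub: "v \<in> S" if v: "v \<in> set xs" for v
  proof -
    obtain i where i: "i < length xs" "xs ! i = v" using v by (meson in_set_conv_nth)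
    show ?thesis
    proof (cases "Suc i < length xs")
      case True then show ?thesis using step[of i] i by simp
    next
      case False
      then have "i = length xs - 1" using i by simp
      then show ?thesis using i xs by (simp add: last_conv_nth assms(6))
    qed
  qed
  have "graph_cycle T (y # xs)"
    unfolding graph_cycle_def
  proof (intro conjI allI impI)
    show "3 \<le> length (y # xs)" using len by simp
    show "distinct (y # xs)" using xs(4) sub assms(3) by auto
    fix i assume i: "i < length (y # xs)"
    show "{(y # xs) ! i, (y # xs) ! (Suc i mod length (y # xs))} \<in> edges T"
    \<comment> \<open>Position 0 is the edge from \<open>y\<close> to \<open>x\<close>, the last
      position is the closing edge from \<open>z\<close> back to \<open>y\<close>, and all others
      are steps of the path.\<close>
    proof (cases i)
      case 0
      then show ?thesis using xs assms(5) len abys by (simp add: insert_commute)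
    next
      case (Suc j)
      show ?thesis
      proof (cases "Suc j < length xs")
        case True
        then show ?thesis using step[of j] Suc by (simp add: adjacency_def)
      next
        case False
        then have "Suc j = length xs" using i Suc by simp
        then show ?thesis using Suc xs(1,3) assms(7)
          by (metis diff_Suc_1 last_conv_nth length_Cons mod_self nth_Cons_0 nth_Cons_Suc)
      qed
    qed
  qed
  then show False using assms(1) by (auto simp: tree_def)
qed

text \<open>Induction over the vertices of a tree, where each new vertex \<open>y\<close> hangs on
  the current set by a single edge. The start \<open>S0\<close> may be any connected set, so that an
  embedding can be prescribed on it.\<close>

lemma tree_grow_induct:
  assumes tree: "tree T"
    and start: "S0 \<subseteq> vertices T" "S0 \<noteq> {}" "connected_on T S0" "P S0"
    and step: "\<And>S x y. S0 \<subseteq> S \<Longrightarrow> S \<subseteq> vertices T \<Longrightarrow> x \<in> S \<Longrightarrow> y \<in> vertices T - S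
      \<Longrightarrow> {x, y} \<in> edges T \<Longrightarrow> (\<And>z. z \<in> S \<Longrightarrow> {z, y} \<in> edges T \<Longrightarrow> z = x)
      \<Longrightarrow> P S \<Longrightarrow> P (insert y S)"
  shows "P (vertices T)"
proof -
  have simple: "simple_graph T" and conn: "connected_graph T" using tree by (auto simp: tree_def)
  have fin: "finite (vertices T)" using simple by (rule simple_graphD)
  have "P (vertices T)" if "S0 \<subseteq> S" "S \<subseteq> vertices T" "connected_on T S" "P S" for S
    using that
  proof (induction "card (vertices T - S)" arbitrary: S rule: less_induct)
    case less
    show ?case
    proof (cases "S = vertices T")
      case True then show ?thesis using less by simp
    next
      case False
      then obtain x y where xy: "x \<in> S" "y \<in> vertices T - S" "{x, y} \<in> edges T"
        using boundary_edge[OF simple conn] less.prems start(2) by (metis subset_empty)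
      have "z = x" if "z \<in> S" "{z, y} \<in> edges T" for z
        using tree_unique_attachment[OF tree less.prems(3)] xy that by blast
      then have P: "P (insert y S)" using step less.prems xy by blast
      have "vertices T - insert y S \<subset> vertices T - S" using xy by blast
      then have "card (vertices T - insert y S) < card (vertices T - S)"
        using fin by (simp add: psubset_card_mono)
      then show ?thesis
        using less.hyps less.prems P connected_on_insert[OF less.prems(3)] xy by blast
    qed
  qed
  then show ?thesis using start by blast
qed

section \<open>Bipartitions of trees and the value of \<open>tree_beta\<close>\<close>

lemma tree_bipartite:
  assumes "tree T"
  obtains V1 V2 where "bipartition T V1 V2"
proof -
  have simple: "simple_graph T" using assms by (simp add: tree_def)
  obtain r where r: "r \<in> vertices T" using assms by (auto simp: tree_def connected_graph_def)
  let ?P = "\<lambda>S. \<exists>C. \<forall>u\<in>S. \<forall>v\<in>S. {u, v} \<in> edges T \<longrightarrow> (u \<in> C) \<noteq> (v \<in> C)"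
  have "?P (vertices T)"
  proof (rule tree_grow_induct[OF assms, of "{r}"])
    show "?P {r}" using simple_graphD(3)[OF simple] by blast
    fix S x y
    assume S: "x \<in> S" "y \<in> vertices T - S" "{x, y} \<in> edges T"
      and uniq: "\<And>z. z \<in> S \<Longrightarrow> {z, y} \<in> edges T \<Longrightarrow> z = x" and "?P S"
    then obtain C where C: "\<forall>u\<in>S. \<forall>v\<in>S. {u, v} \<in> edges T \<longrightarrow> (u \<in> C) \<noteq> (v \<in> C)" by blast
    \<comment> \<open>The new vertex \<open>y\<close> gets the colour opposite to that of
      \<open>x\<close>, its only neighbour coloured so far; old vertices keep theirs.\<close>
    define D where "D = (if x \<in> C then C - {y} else insert y C)"
    have yy: "{y, y} \<notin> edges T" using simple_graphD(3)[OF simple] by blast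
    have uniq': "\<And>z. z \<in> S \<Longrightarrow> {y, z} \<in> edges T \<Longrightarrow> z = x" using uniq by (simp add: insert_commute)
    have D: "z \<in> D \<longleftrightarrow> z \<in> C" if "z \<in> S" for z using that S(2) by (auto simp: D_def)
    have yD: "y \<in> D \<longleftrightarrow> x \<notin> D" using S by (auto simp: D_def)
    have "(u \<in> D) \<noteq> (v \<in> D)"
      if uv: "u \<in> insert y S" "v \<in> insert y S" "{u, v} \<in> edges T" for u v
    proof (cases "u = y")
      case True
      then have "v = x" using uv yy uniq' by blast
      then show ?thesis using True yD by simp
    next
      case u: False
      show ?thesis
      proof (cases "v = y")
        case True
        then have "u = x" using uv u uniq by blast
        then show ?thesis using True yD by simp
      next
        case False
        then show ?thesis using u uv C D by simp
      qed
    qed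
    then show "?P (insert y S)" by blast
  qed (use r in \<open>auto simp: connected_on_def\<close>)
  then obtain C where C: "\<forall>u\<in>vertices T. \<forall>v\<in>vertices T. {u, v} \<in> edges T \<longrightarrow> (u \<in> C) \<noteq> (v \<in> C)"
    by blast
  have "bipartition T (vertices T \<inter> C) (vertices T - C)"
    unfolding bipartition_def
  proof (intro conjI ballI)
    fix e assume e: "e \<in> edges T"
    then obtain u v where uv: "e = {u, v}" using simple_graphD(4)[OF simple] by blast
    then have "u \<in> vertices T" "v \<in> vertices T" using e simple_graphD(3)[OF simple] by blast+
    then show "\<exists>u\<in>vertices T \<inter> C. \<exists>v\<in>vertices T - C. e = {u, v}"
      using C e uv by (metis Diff_iff IntI insert_commute)
  qed auto
  then show thesis by (rule that)
qed

lemma bipartition_edge: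
  assumes "bipartition G V1 V2" and "{x, y} \<in> edges G"
  shows "x \<in> V1 \<longleftrightarrow> y \<in> V2" and "x \<in> V2 \<longleftrightarrow> y \<in> V1"
proof -
  obtain u v where "u \<in> V1" "v \<in> V2" "{x, y} = {u, v}"
    using assms by (auto simp: bipartition_def)
  moreover have "V1 \<inter> V2 = {}" using assms by (simp add: bipartition_def)
  ultimately show "x \<in> V1 \<longleftrightarrow> y \<in> V2" and "x \<in> V2 \<longleftrightarrow> y \<in> V1"
    by (auto simp: doubleton_eq_iff)
qed

text \<open>Along an edge both colourings flip, so no edge leaves the set of vertices on which they
  agree. By connectedness that set is empty or everything.\<close>

lemma bipartition_unique:
  assumes "simple_graph G" and "connected_graph G"
    and V: "bipartition G V1 V2" and U: "bipartition G U1 U2"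
  shows "U1 = V1 \<and> U2 = V2 \<or> U1 = V2 \<and> U2 = V1"
proof -
  let ?S = "{v \<in> vertices G. v \<in> V1 \<longleftrightarrow> v \<in> U1}"
  have part: "V1 \<union> V2 = vertices G" "V1 \<inter> V2 = {}" "U1 \<union> U2 = vertices G" "U1 \<inter> U2 = {}"
    using V U by (auto simp: bipartition_def)
  have "?S = {} \<or> ?S = vertices G"
  proof (rule ccontr)
    assume *: "\<not> ?thesis"
    obtain x y where "x \<in> ?S" "y \<in> vertices G - ?S" "{x, y} \<in> edges G"
      by (rule boundary_edge[OF assms(1,2), of ?S]) (use * in auto)
    then show False using bipartition_edge[OF V] bipartition_edge[OF U] part by blast
  qed
  then show ?thesis using part by blast
qed

text \<open>Two bipartitions differ at most by a swap, which leaves the minimum unchanged, so the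
  definite description in \<open>tree_beta\<close> is well defined.\<close>

lemma tree_betaE:
  assumes "tree T" and "graph_order T \<noteq> 1"
  obtains V1 V2 where "bipartition T V1 V2" and "card V1 = tree_beta T" and "card V1 \<le> card V2"
proof -
  obtain U1 U2 where U: "bipartition T U1 U2" using tree_bipartite[OF assms(1)] .
  define V1 where "V1 = (if card U1 \<le> card U2 then U1 else U2)"
  define V2 where "V2 = (if card U1 \<le> card U2 then U2 else U1)"
  have "bipartition T U2 U1"
    using U unfolding bipartition_def by (metis Int_commute Un_commute insert_commute)
  then have V: "bipartition T V1 V2" using U by (simp add: V1_def V2_def)
  have le: "card V1 \<le> card V2" by (simp add: V1_def V2_def)
  have "(THE b. \<exists>V1 V2. bipartition T V1 V2 \<and> b = min (card V1) (card V2)) = card V1"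
  proof (rule the_equality)
    show "\<exists>V1' V2'. bipartition T V1' V2' \<and> card V1 = min (card V1') (card V2')"
      using V le by (metis min.absorb1)
    fix b assume "\<exists>V1 V2. bipartition T V1 V2 \<and> b = min (card V1) (card V2)"
    then show "b = card V1"
      using bipartition_unique[OF _ _ V] assms(1) le unfolding tree_def
      by (metis min.absorb1 min.commute)
  qed
  then show thesis using that V le assms(2) by (simp add: tree_beta_def)
qed


subsection \<open>Greedy embedding\<close>

text \<open>Relative to \<open>S\<close>, so that it can serve as an invariant while the tree grows.
  The copy need not be induced.\<close>

definition embeds :: "'a ugraph \<Rightarrow> 'b ugraph \<Rightarrow> 'a set \<Rightarrow> ('a \<Rightarrow> 'b) \<Rightarrow> bool" where
  "embeds T G S f \<longleftrightarrow> inj_on f S \<and> f ` S \<subseteq> vertices G \<and>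
    (\<forall>x\<in>S. \<forall>y\<in>S. {x, y} \<in> edges T \<longrightarrow> {f x, f y} \<in> edges G)"

text \<open>Greedy choice: the image of the parent \<open>x\<close> has at least
  \<open>card (vertices T) - 1\<close> neighbours, while fewer than that many vertices other than
  this image are occupied, so a free neighbour remains for \<open>y\<close>.\<close>

lemma tree_embedding_extend:
  assumes "tree T" and "simple_graph G" and deg: "card (vertices T) - 1 \<le> min_degree G"
    and S0: "S0 \<subseteq> vertices T" "S0 \<noteq> {}" "connected_on T S0" and f0: "embeds T G S0 f0"
  obtains f where "embeds T G (vertices T) f" and "\<And>x. x \<in> S0 \<Longrightarrow> f x = f0 x"
proof -
  have simple: "simple_graph T" using assms(1) by (simp add: tree_def)
  have fin: "finite (vertices T)" using simple by (rule simple_graphD)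
  have "\<exists>f. embeds T G (vertices T) f \<and> (\<forall>x\<in>S0. f x = f0 x)"
  proof (rule tree_grow_induct[OF assms(1) S0])
    show "\<exists>f. embeds T G S0 f \<and> (\<forall>x\<in>S0. f x = f0 x)" using f0 by blast
    fix S x y
    assume S: "S0 \<subseteq> S" "S \<subseteq> vertices T" and xy: "x \<in> S" "y \<in> vertices T - S" "{x, y} \<in> edges T"
      and uniq: "\<And>z. z \<in> S \<Longrightarrow> {z, y} \<in> edges T \<Longrightarrow> z = x"
      and "\<exists>f. embeds T G S f \<and> (\<forall>x\<in>S0. f x = f0 x)"
    then obtain f where f: "embeds T G S f" "\<forall>x\<in>S0. f x = f0 x" by blast
    have fx: "f x \<in> vertices G" using f xy by (auto simp: embeds_def)
    have finS: "finite S" using S fin finite_subset by blast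
    \<comment> \<open>The vertex \<open>f x\<close> is occupied but is not its own neighbour;
      leaving it out makes the count strict.\<close>
    have "card (f ` S - {f x}) < card (f ` S)"
      using finS xy by (metis card_Diff1_less finite_imageI imageI)
    also have "card (f ` S) \<le> card S" using finS by (rule card_image_le)
    also have "card S \<le> card (vertices T - {y})" using S xy fin by (intro card_mono) auto
    also have "\<dots> = card (vertices T) - 1" using xy fin by simp
    also have "\<dots> \<le> card (neighbours G (f x))" using deg min_degree_le[OF assms(2) fx] by simp
    finally have "\<not> neighbours G (f x) \<subseteq> f ` S - {f x}"
      using finS by (meson card_mono finite_Diff finite_imageI leD)
    then obtain w where w: "w \<in> neighbours G (f x)" "w \<notin> f ` S"
      using neighbours_subset[OF assms(2)] by fast
    have fw: "{f x, w} \<in> edges G" "{w, f x} \<in> edges G" "w \<in> vertices G"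
      using w simple_graphD(3)[OF assms(2)] by (auto simp: neighbours_def insert_commute)
    have yy: "{y, y} \<notin> edges T" using simple_graphD(3)[OF simple] by blast
    have uniq': "z = x" if "z \<in> S" "{y, z} \<in> edges T" for z
      using uniq that by (simp add: insert_commute)
    have agree: "(f(y := w)) z = f z" if "z \<in> S" for z using that xy by auto
    have "inj_on (f(y := w)) (insert y S)"
      using f(1) w(2) xy(2) agree by (auto simp: embeds_def inj_on_def)
    moreover have "f(y := w) ` insert y S \<subseteq> vertices G"
      using f(1) fw(3) by (auto simp: embeds_def)
    moreover have "{(f(y := w)) u, (f(y := w)) v} \<in> edges G"
      if uv: "u \<in> insert y S" "v \<in> insert y S" "{u, v} \<in> edges T" for u v
    proof (cases "u = y")
      case True
      then have "v = x" using uv yy uniq' by blast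
      then show ?thesis using True agree[OF xy(1)] fw by simp
    next
      case u: False
      show ?thesis
      proof (cases "v = y")
        case True
        then have "u = x" using uv u uniq by blast
        then show ?thesis using True agree[OF xy(1)] fw by simp
      next
        case False
        then show ?thesis using u uv f(1) by (simp add: embeds_def)
      qed
    qed
    ultimately have "embeds T G (insert y S) (f(y := w))" by (simp add: embeds_def)
    moreover have "\<forall>z\<in>S0. (f(y := w)) z = f0 z" using f(2) S(1) xy(2) by auto
    ultimately show "\<exists>f. embeds T G (insert y S) f \<and> (\<forall>x\<in>S0. f x = f0 x)" by blast
  qed
  then show thesis using that by blast
qed

section \<open>Copies of a graph under injective maps\<close>

definition graph_image :: "('a \<Rightarrow> 'b) \<Rightarrow> 'a ugraph \<Rightarrow> 'b ugraph" where
  "graph_image f T = \<lparr>vertices = f ` vertices T, edges = (`) f ` edges T\<rparr>"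

lemma graph_image_edge:
  assumes "simple_graph T" and "inj_on f (vertices T)" and "x \<in> vertices T" and "y \<in> vertices T"
  shows "{f x, f y} \<in> edges (graph_image f T) \<longleftrightarrow> {x, y} \<in> edges T"
proof
  assume "{f x, f y} \<in> edges (graph_image f T)"
  then obtain e where e: "e \<in> edges T" "f ` {x, y} = f ` e" by (auto simp: graph_image_def)
  have "{x, y} \<subseteq> vertices T" "e \<subseteq> vertices T" using e assms by (simp_all add: simple_graph_def)
  then have "{x, y} = e" using e(2) by (rule inj_on_image_eq_iff[OF assms(2), THEN iffD1])
  then show "{x, y} \<in> edges T" using e by simp
next
  assume "{x, y} \<in> edges T"
  then have "f ` {x, y} \<in> edges (graph_image f T)" unfolding graph_image_def by (simp del: image_insert)
  then show "{f x, f y} \<in> edges (graph_image f T)" by simp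
qed

lemma neighbours_graph_image:
  assumes "simple_graph T" and "inj_on f (vertices T)" and "x \<in> vertices T"
  shows "neighbours (graph_image f T) (f x) = f ` neighbours T x"
proof (intro equalityI subsetI)
  fix w assume w: "w \<in> neighbours (graph_image f T) (f x)"
  then obtain e where e: "e \<in> edges T" "{f x, w} = f ` e"
    by (auto simp: graph_image_def neighbours_def)
  then have "e \<subseteq> vertices T" using assms(1) by (auto simp: simple_graph_def)
  then obtain y where "y \<in> vertices T" "w = f y" using e(2) by blast
  then show "w \<in> f ` neighbours T x"
    using w graph_image_edge[OF assms(1,2,3)] by (auto simp: neighbours_def)
next
  fix w assume "w \<in> f ` neighbours T x"
  then show "w \<in> neighbours (graph_image f T) (f x)"
    using neighbours_subset[OF assms(1)] graph_image_edge[OF assms] by (auto simp: neighbours_def)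
qed

lemma simple_graph_image:
  assumes "simple_graph T" and "inj_on f (vertices T)"
  shows "simple_graph (graph_image f T)"
  unfolding simple_graph_def
proof (intro conjI ballI)
  show "finite (vertices (graph_image f T))" using assms by (simp add: graph_image_def simple_graph_def)
  fix e assume "e \<in> edges (graph_image f T)"
  then obtain d where d: "d \<in> edges T" "e = f ` d" by (auto simp: graph_image_def)
  then have "d \<subseteq> vertices T" "card d = 2" using assms(1) by (auto simp: simple_graph_def)
  then show "e \<subseteq> vertices (graph_image f T)" "card e = 2"
    using d assms(2) by (auto simp: graph_image_def card_image inj_on_subset)
qed

text \<open>Walks are pushed forward along \<open>f\<close>; a cycle in the image would be pulled
  back by the inverse of \<open>f\<close> to a cycle in \<open>T\<close>.\<close>

lemma tree_graph_image:
  assumes "tree T" and inj: "inj_on f (vertices T)"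
  shows "tree (graph_image f T)"
proof -
  have simple: "simple_graph T" and conn: "connected_graph T" and acyclic: "\<nexists>c. graph_cycle T c"
    using assms(1) by (auto simp: tree_def)
  let ?H = "graph_image f T"
  note simpleH = simple_graph_image[OF simple inj]
  have "(f u, f v) \<in> (adjacency ?H)\<^sup>*" if "(u, v) \<in> (adjacency T)\<^sup>*" for u v
    using that
  proof (induction rule: rtrancl_induct)
    case (step y z)
    then have "{y, z} \<in> edges T" by (simp add: adjacency_def)
    then have "(f y, f z) \<in> adjacency ?H"
      using graph_image_edge[OF simple inj] simple_graphD(3)[OF simple] by (auto simp: adjacency_def)
    then show ?case using step by simp
  qed simp
  then have "connected_graph ?H"
    using conn by (auto simp: connected_graph_def graph_image_def)
  moreover have False if c: "graph_cycle ?H c" for c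
  proof -
    let ?g = "inv_into (vertices T) f"
    have n: "3 \<le> length c" and "distinct c"
      and e: "\<And>i. i < length c \<Longrightarrow> {c ! i, c ! (Suc i mod length c)} \<in> edges ?H"
      using c by (auto simp: graph_cycle_def)
    have inV: "c ! i \<in> f ` vertices T" if "i < length c" for i
      using simple_graphD(3)[OF simpleH e[OF that]] by (simp add: graph_image_def)
    have "set c \<subseteq> f ` vertices T" using inV by (auto simp: in_set_conv_nth)
    then have "distinct (map ?g c)"
      using \<open>distinct c\<close> by (simp add: distinct_map inj_on_inv_into)
    moreover have "{map ?g c ! i, map ?g c ! (Suc i mod length c)} \<in> edges T" if i: "i < length c" for i
    proof -
      have j: "Suc i mod length c < length c" using n by (intro mod_less_divisor) linarith
      have "{f (?g (c ! i)), f (?g (c ! (Suc i mod length c)))} \<in> edges ?H"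
        using e[OF i] inV[OF i] inV[OF j] by (simp add: f_inv_into_f)
      then have "{?g (c ! i), ?g (c ! (Suc i mod length c))} \<in> edges T"
        using graph_image_edge[OF simple inj] inv_into_into[OF inV[OF i]] inv_into_into[OF inV[OF j]]
        by blast
      then show ?thesis using i j by simp
    qed
    ultimately have "graph_cycle T (map ?g c)" using n by (simp add: graph_cycle_def)
    then show False using acyclic by blast
  qed
  ultimately show ?thesis using simpleH by (auto simp: tree_def)
qed

lemma graph_iso_image:
  assumes "simple_graph T" and "inj_on f (vertices T)"
  shows "graph_iso (graph_image f T) T"
proof -
  let ?g = "inv_into (vertices T) f"
  have "bij_betw ?g (f ` vertices T) (vertices T)"
    using assms(2) by (simp add: bij_betw_inv_into inj_on_imp_bij_betw)
  moreover have "{f u, f v} \<in> edges (graph_image f T) \<longleftrightarrow> {?g (f u), ?g (f v)} \<in> edges T"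
    if "u \<in> vertices T" "v \<in> vertices T" for u v
    using graph_image_edge[OF assms that] assms(2) that by simp
  ultimately show ?thesis unfolding graph_iso_def
    by (intro exI[of _ ?g]) (auto simp: graph_image_def)
qed

lemma subtree_graph_image:
  assumes "tree T" and "embeds T G (vertices T) f"
  shows "subtree (graph_image f T) G"
proof -
  have simple: "simple_graph T" using assms(1) by (simp add: tree_def)
  have "e \<in> edges G" if e: "e \<in> edges (graph_image f T)" for e
  proof -
    obtain d where d: "d \<in> edges T" "e = f ` d" using e by (auto simp: graph_image_def)
    then obtain x y where "d = {x, y}" using simple_graphD(4)[OF simple] by blast
    then show ?thesis using d simple_graphD(3)[OF simple] assms(2) by (auto simp: embeds_def)
  qed
  then show ?thesis
    using assms tree_graph_image[OF assms(1)] simple_graph_image[OF simple]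
    by (auto simp: subtree_def subgraph_def embeds_def graph_image_def)
qed


subsection \<open>Edge cuts\<close>

definition edge_cut :: "'a ugraph \<Rightarrow> 'a set \<Rightarrow> 'a set set" where
  "edge_cut G X = {e. \<exists>x\<in>X. \<exists>y\<in>vertices G - X. e = {x, y} \<and> e \<in> edges G}"

lemma edge_cut_complement:
  assumes "X \<subseteq> vertices G"
  shows "edge_cut G (vertices G - X) = edge_cut G X"
proof -
  have "(\<exists>x\<in>vertices G - X. \<exists>y\<in>X. e = {x, y} \<and> e \<in> edges G) \<longleftrightarrow>
      (\<exists>x\<in>X. \<exists>y\<in>vertices G - X. e = {x, y} \<and> e \<in> edges G)" for e
    by (subst insert_commute) blast
  moreover have "vertices G - (vertices G - X) = X" using assms by blast
  ultimately show ?thesis by (simp add: edge_cut_def)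
qed

lemma simple_delete_edges: "simple_graph G \<Longrightarrow> simple_graph (delete_edges G F)"
  by (auto simp: simple_graph_def delete_edges_def)

lemma finite_edge_cut: "simple_graph G \<Longrightarrow> finite (edge_cut G X)"
  using simple_graphD(2) by (rule finite_subset[rotated]) (auto simp: edge_cut_def)

text \<open>If deleting \<open>F\<close> disconnects \<open>G\<close>, then \<open>F\<close>
  contains the whole cut around a component of what is left. With two or more vertices the trivial
  graph cannot arise.\<close>

lemma k_edge_connectedI:
  assumes "simple_graph G" and "2 \<le> card (vertices G)"
    and cuts: "\<And>X. X \<subseteq> vertices G \<Longrightarrow> X \<noteq> {} \<Longrightarrow> X \<noteq> vertices G \<Longrightarrow> k \<le> card (edge_cut G X)"
  shows "k_edge_connected k G"
proof -
  let ?Q = "\<lambda>n. \<exists>F\<subseteq>edges G. card F = n \<and>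
     (\<not> connected_graph (delete_edges G F) \<or> graph_order (delete_edges G F) = 1)"
  have order: "graph_order (delete_edges G F) \<noteq> 1" for F
    using assms(2) by (simp add: graph_order_def delete_edges_def)
  have le: "k \<le> card F" if F: "F \<subseteq> edges G" "\<not> connected_graph (delete_edges G F)" for F
  proof -
    let ?D = "delete_edges G F"
    have "vertices G \<noteq> {}" using assms(2) by auto
    then obtain u v where uv: "u \<in> vertices G" "v \<in> vertices G" "(u, v) \<notin> (adjacency ?D)\<^sup>*"
      using F(2) by (auto simp: connected_graph_def delete_edges_def)
    \<comment> \<open>The component of \<open>u\<close> after deletion of \<open>F\<close>; it
      misses \<open>v\<close>.\<close>
    define X where "X = {x \<in> vertices G. (u, x) \<in> (adjacency ?D)\<^sup>*}"
    have "edge_cut G X \<subseteq> F"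
    proof
      fix e assume "e \<in> edge_cut G X"
      then obtain x y where e: "x \<in> X" "y \<in> vertices G - X" "e = {x, y}" "e \<in> edges G"
        by (auto simp: edge_cut_def)
      show "e \<in> F"
      proof (rule ccontr)
        assume "e \<notin> F"
        then have "(x, y) \<in> adjacency ?D" using e by (simp add: adjacency_def delete_edges_def)
        then have "(u, y) \<in> (adjacency ?D)\<^sup>*" using e(1) by (auto simp: X_def)
        then show False using e(2) by (simp add: X_def)
      qed
    qed
    moreover have "finite F" using F(1) simple_graphD(2)[OF assms(1)] finite_subset by blast
    moreover have "k \<le> card (edge_cut G X)" using uv by (intro cuts) (auto simp: X_def)
    ultimately show ?thesis by (meson card_mono le_trans)
  qed
  \<comment> \<open>The \<open>LEAST\<close> in \<open>edge_connectivity\<close> needs some witness: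
    deleting all edges disconnects a graph with at least two vertices.\<close>
  have "\<not> connected_graph (delete_edges G (edges G))"
  proof
    assume c: "connected_graph (delete_edges G (edges G))"
    have "adjacency (delete_edges G (edges G)) = {}" by (simp add: adjacency_def delete_edges_def)
    then have "\<forall>u\<in>vertices G. \<forall>v\<in>vertices G. u = v"
      using c by (simp add: connected_graph_def delete_edges_def)
    then have "card (vertices G) \<le> Suc 0"
      using simple_graphD(1)[OF assms(1)] by (simp add: card_le_Suc0_iff_eq)
    then show False using assms(2) by simp
  qed
  then have "?Q (card (edges G))" by blast
  then have "?Q (LEAST n. ?Q n)" by (rule LeastI)
  then have "k \<le> (LEAST n. ?Q n)" using le order by metis
  then show ?thesis by (simp add: k_edge_connected_def edge_connectivity_def)
qed

text \<open>If \<open>G\<close> were disconnected, the empty deletion set would already give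
  edge-connectivity 0. The assumption on the order excludes the convention for one vertex.\<close>

lemma connected_if_k_edge_connected:
  assumes "k_edge_connected k G" and "1 \<le> k" and "graph_order G \<noteq> 1"
  shows "connected_graph G"
proof (rule ccontr)
  assume "\<not> connected_graph G"
  then have "\<exists>F\<subseteq>edges G. card F = 0 \<and>
     (\<not> connected_graph (delete_edges G F) \<or> graph_order (delete_edges G F) = 1)"
    by (intro exI[of _ "{}"]) (cases G, simp add: delete_edges_def)
  then have "edge_connectivity G = 0" unfolding edge_connectivity_def by (simp add: Least_eq_0)
  then show False using assms by (auto simp: k_edge_connected_def)
qed

text \<open>Send a neighbour \<open>z\<close> of \<open>v\<close> to the edge \<open>vz\<close> if \<open>z\<close> lies across the cut, and to some
  cut edge at \<open>z\<close> otherwise. The endpoint in \<open>X\<close> tells these edges apart.\<close>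

lemma card_edge_cut_ge:
  assumes "simple_graph G" and "v \<in> X" and "N \<subseteq> neighbours G v"
    and out: "\<And>z. z \<in> N \<inter> X \<Longrightarrow> neighbours G z - X \<noteq> {}"
  shows "card N \<le> card (edge_cut G X)"
proof -
  have "\<exists>y. y \<in> neighbours G z - X" if "z \<in> N \<inter> X" for z using out[OF that] by blast
  then obtain g where g: "\<And>z. z \<in> N \<inter> X \<Longrightarrow> g z \<in> neighbours G z - X" by metis
  define h where "h = (\<lambda>z. if z \<in> X then {z, g z} else {v, z})"
  \<comment> \<open>So an edge chosen at some \<open>z\<close> in \<open>X\<close> never has
    \<open>v\<close> as its endpoint in \<open>X\<close>; two edges at \<open>v\<close> differ in
    the endpoint outside.\<close>
  have vN: "v \<notin> N" using assms(3) neighbours_subset[OF assms(1)] by blast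
  have "inj_on h N"
  proof (rule inj_onI)
    fix a b assume ab: "a \<in> N" "b \<in> N" "h a = h b"
    have "g a \<notin> X" if "a \<in> X" using g that ab by blast
    moreover have "g b \<notin> X" if "b \<in> X" using g that ab by blast
    ultimately show "a = b"
      using ab vN assms(2) by (auto simp: h_def doubleton_eq_iff split: if_splits)
  qed
  moreover have "h ` N \<subseteq> edge_cut G X"
  proof
    fix e assume "e \<in> h ` N"
    then obtain z where z: "z \<in> N" "e = h z" by blast
    show "e \<in> edge_cut G X"
    proof (cases "z \<in> X")
      case True
      then have "g z \<in> neighbours G z - X" using g z by blast
      then have "g z \<in> vertices G - X" "{z, g z} \<in> edges G"
        using neighbours_subset[OF assms(1)] by (auto simp: neighbours_def)
      then show ?thesis using z True by (auto simp: h_def edge_cut_def)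
    next
      case False
      then have "z \<in> vertices G - X" "{v, z} \<in> edges G"
        using z assms(3) neighbours_subset[OF assms(1)] by (auto simp: neighbours_def)
      then show ?thesis using z False assms(2) by (auto simp: h_def edge_cut_def)
    qed
  qed
  ultimately show ?thesis using finite_edge_cut[OF assms(1)] by (rule card_inj_on_le)
qed


text \<open>Because of \<open>diam\<close>, for every cut one of the two sides consists, up to \<open>W\<close>, of vertices
  with a neighbour across.\<close>

lemma k_edge_connected_diameter_2:
  assumes simple: "simple_graph G" and "2 \<le> card (vertices G)"
    and deg: "\<And>v. v \<in> vertices G \<Longrightarrow> k \<le> card (neighbours G v - W)"
    and diam: "\<And>u v. u \<in> vertices G - W \<Longrightarrow> v \<in> vertices G - W \<Longrightarrow> u \<noteq> v \<Longrightarrow>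
      {u, v} \<in> edges G \<or> (\<exists>z. {u, z} \<in> edges G \<and> {v, z} \<in> edges G)"
  shows "k_edge_connected k G"
proof (rule k_edge_connectedI[OF assms(1,2)])
  \<comment> \<open>A neighbour across is required only outside \<open>W\<close>, which suffices
    because the neighbours of \<open>v\<close> counted by \<open>deg\<close> all lie outside
    \<open>W\<close>.\<close>
  have one_side: "k \<le> card (edge_cut G X)"
    if X: "X \<subseteq> vertices G" "X \<noteq> {}" and out: "\<And>x. x \<in> X - W \<Longrightarrow> neighbours G x - X \<noteq> {}" for X
  proof -
    obtain v where v: "v \<in> X" using X by blast
    then have "k \<le> card (neighbours G v - W)" using X deg by blast
    also have "\<dots> \<le> card (edge_cut G X)"
      by (rule card_edge_cut_ge[OF simple v]) (use out in auto)
    finally show ?thesis .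
  qed
  fix X
  assume X: "X \<subseteq> vertices G" "X \<noteq> {}" "X \<noteq> vertices G"
  show "k \<le> card (edge_cut G X)"
  proof (cases "\<forall>x\<in>X - W. neighbours G x - X \<noteq> {}")
    case True
    then show ?thesis using one_side X by blast
  next
    case False
    \<comment> \<open>All neighbours of \<open>u\<close> are on its own side. Hence every
      \<open>v\<close> in the other side minus \<open>W\<close> is non-adjacent to \<open>u\<close>,
      and their common neighbour lies in \<open>X\<close>, across the cut from
      \<open>v\<close>.\<close>
    then obtain u where u: "u \<in> X - W" "neighbours G u \<subseteq> X" by blast
    let ?Y = "vertices G - X"
    have "neighbours G v - ?Y \<noteq> {}" if v: "v \<in> ?Y - W" for v
    proof -
      have "{u, v} \<notin> edges G" using u v by (auto simp: neighbours_def)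
      then obtain z where "{u, z} \<in> edges G" "{v, z} \<in> edges G"
        using diam[of u v] u v X(1) by blast
      then have "z \<in> neighbours G v" "z \<in> X" using u by (auto simp: neighbours_def)
      then show ?thesis by blast
    qed
    then have "k \<le> card (edge_cut G ?Y)" using one_side X by blast
    then show ?thesis using edge_cut_complement[OF X(1)] by simp
  qed
qed


subsection \<open>Joins\<close>

text \<open>Keeps only the complete bipartite graph between the parts; the cograph structure inside
  them is forgotten.\<close>

definition join_parts :: "'a ugraph \<Rightarrow> 'a set \<Rightarrow> 'a set \<Rightarrow> bool" where
  "join_parts G A B \<longleftrightarrow> A \<noteq> {} \<and> B \<noteq> {} \<and> A \<inter> B = {} \<and> A \<union> B = vertices G \<and>
    (\<forall>a\<in>A. \<forall>b\<in>B. {a, b} \<in> edges G)"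

lemma join_parts_sym: "join_parts G A B \<Longrightarrow> join_parts G B A"
  unfolding join_parts_def by (simp add: Int_commute Un_commute) (metis insert_commute)

text \<open>The last step building \<open>G\<close> cannot be a disjoint union, since connectedness
  would force an edge between the two pieces.\<close>

lemma connected_cograph_join:
  assumes "cograph G" and "connected_graph G" and "graph_order G \<noteq> 1"
  obtains A B where "join_parts G A B"
  using assms(1)
proof cases
  case (cograph_single v)
  then show thesis using assms(3) by (simp add: graph_order_def single_vertex_def)
next
  case (cograph_union G1 G2)
  have s: "simple_graph G1" "simple_graph G2"
    using cograph_union cograph_simple_graph by blast+
  have ne: "vertices G1 \<noteq> {}" "vertices G2 \<noteq> {}" using cograph_union cograph_nonempty by blast+
  have V: "vertices G = vertices G1 \<union> vertices G2" "edges G = edges G1 \<union> edges G2"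
    using cograph_union by (simp_all add: graph_union_def)
  obtain x y where "x \<in> vertices G1" "y \<in> vertices G - vertices G1" "{x, y} \<in> edges G"
    by (rule boundary_edge[OF cograph_simple_graph[OF assms(1)] assms(2), of "vertices G1"])
      (use V ne cograph_union in auto)
  then show thesis using V cograph_union(4) simple_graphD(3)[OF s(1)] simple_graphD(3)[OF s(2)]
    by blast
next
  case (cograph_join G1 G2)
  then have "join_parts G (vertices G1) (vertices G2)"
    using cograph_nonempty by (auto simp: join_parts_def graph_join_def)
  then show thesis by (rule that)
qed

text \<open>By injectivity the image of \<open>V2\<close> avoids that of \<open>V1\<close>, so a
  part is safe once it receives a vertex of \<open>V2\<close>. It is also safe if it has more than
  \<open>card V1\<close> vertices.\<close>

lemma tree_embedding_avoiding:
  assumes tree: "tree T" and bip: "bipartition T V1 V2" and V12: "card V1 \<le> card V2" "V1 \<noteq> {}"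
    and simple: "simple_graph G" and deg: "card (vertices T) - 1 \<le> min_degree G"
    and deg1: "card V1 < min_degree G" and join: "join_parts G A B" and AB: "card A \<le> card B"
  obtains f where "embeds T G (vertices T) f" and "A - f ` V1 \<noteq> {}" and "B - f ` V1 \<noteq> {}"
proof -
  have simpleT: "simple_graph T" and connT: "connected_graph T" using tree by (auto simp: tree_def)
  have VT: "V1 \<union> V2 = vertices T" "V1 \<inter> V2 = {}" using bip by (auto simp: bipartition_def)
  have fin: "finite (vertices T)" using simpleT by (rule simple_graphD)
  then have fin12: "finite V1" "finite V2" using VT by (metis finite_Un)+
  have AB': "A \<inter> B = {}" "A \<union> B = vertices G" and cross: "\<And>a b. a \<in> A \<Longrightarrow> b \<in> B \<Longrightarrow> {a, b} \<in> edges G"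
    using join by (auto simp: join_parts_def)
  have finAB: "finite A" "finite B" using AB' simple_graphD(1)[OF simple] by (metis finite_Un)+
  obtain u v where u: "u \<in> A" and v: "v \<in> B" using join by (auto simp: join_parts_def)
  have "card V1 > 0" using V12 fin12 by (simp add: card_gt_0_iff)
  then obtain p where p: "p \<in> V2" using V12 by fastforce
  have avoid: "f x \<notin> f ` V1" if "embeds T G (vertices T) f" "x \<in> V2" for f x
    using that VT unfolding embeds_def by (metis UnCI disjoint_iff inj_on_image_mem_iff sup_ge1)
  show thesis
  proof (cases "card V1 < card B")
    \<comment> \<open>Here \<open>B\<close> is too large to be covered, and it is enough to send one
      vertex \<open>p\<close> of \<open>V2\<close> into \<open>A\<close>.\<close>
    case True
    have pp: "{p, p} \<notin> edges T" using simple_graphD(3)[OF simpleT] by blast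
    have f0: "embeds T G {p} (\<lambda>_. u)"
      using u AB' pp by (auto simp: embeds_def)
    obtain f where f: "embeds T G (vertices T) f" "\<And>x. x \<in> {p} \<Longrightarrow> f x = u"
      by (rule tree_embedding_extend[OF tree simple deg _ _ _ f0])
        (use p VT in \<open>auto simp: connected_on_def\<close>)
    have "card (f ` V1) < card B" using True card_image_le[OF fin12(1)] by (rule le_less_trans[rotated])
    then have "\<not> B \<subseteq> f ` V1" using fin12(1) by (meson card_mono finite_imageI leD)
    moreover have "u \<notin> f ` V1" using avoid[OF f(1) p] f(2) by simp
    ultimately show thesis using that f(1) u by blast
  next
    case False
    \<comment> \<open>Both parts now have at most \<open>card V1\<close> vertices, so
      \<open>card V1 < min_degree G < 2 * card V1\<close>. This forces \<open>card V1\<close>, and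
      with it \<open>card V2\<close>, to be at least 2.\<close>
    have "card A + card B = card (vertices G)" using AB' finAB by (metis card_Un_disjoint)
    moreover have "min_degree G < card (vertices G)"
      using min_degree_less_order[OF simple, of u] u AB' by blast
    ultimately have "2 \<le> card V2" using False AB deg1 V12 by linarith
    \<comment> \<open>An edge leaving the closed neighbourhood of \<open>p\<close> yields a path
      \<open>p\<close>, \<open>r\<close>, \<open>q\<close> with both ends in \<open>V2\<close>. The
      ends will be sent to different parts.\<close>
    let ?S = "insert p (neighbours T p)"
    have nbrp: "neighbours T p \<subseteq> V1" using p bipartition_edge[OF bip] by (auto simp: neighbours_def)
    have "?S \<noteq> vertices T"
    proof
      assume "?S = vertices T"
      then have "V2 \<subseteq> {p}" using nbrp VT by blast
      then have "card V2 \<le> card {p}" by (intro card_mono) auto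
      then show False using \<open>2 \<le> card V2\<close> by simp
    qed
    moreover have "?S \<subseteq> vertices T" using nbrp p VT by blast
    ultimately obtain r q where rq: "r \<in> ?S" "q \<in> vertices T - ?S" "{r, q} \<in> edges T"
      using boundary_edge[OF simpleT connT, of ?S] by blast
    then have r: "r \<in> neighbours T p" by (auto simp: neighbours_def)
    then have r1: "r \<in> V1" using nbrp by blast
    then have q: "q \<in> V2" using bipartition_edge(1)[OF bip rq(3)] by blast
    have pr: "{p, r} \<in> edges T" using r by (simp add: neighbours_def)
    have distinct: "p \<noteq> q" "p \<noteq> r" "q \<noteq> r" using rq(2) r1 p q VT by auto
    have no: "{p, q} \<notin> edges T" "{q, p} \<notin> edges T" "\<And>x. {x, x} \<notin> edges T"
      using bipartition_edge[OF bip] p q VT(2) simple_graphD(3)[OF simpleT] by blast+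
    \<comment> \<open>The vertex \<open>v\<close> of \<open>B\<close> has too many neighbours for
      all of them to lie in \<open>A\<close>. A neighbour \<open>w\<close> in \<open>B\<close> is
      adjacent to \<open>u\<close> as well, by the join, and can be the image of
      \<open>r\<close>.\<close>
    have "card A < card (neighbours G v)"
      using False AB deg1 min_degree_le[OF simple, of v] v AB' by fastforce
    then have "\<not> neighbours G v \<subseteq> A" using finAB(1) by (meson card_mono leD)
    then obtain w where w: "w \<in> B" "{v, w} \<in> edges G" "w \<noteq> v"
      using neighbours_subset[OF simple] AB' by (fastforce simp: neighbours_def)
    define f0 where "f0 = (\<lambda>x. if x = p then u else if x = q then v else w)"
    have f0_simps: "f0 p = u" "f0 q = v" "f0 r = w" using distinct by (auto simp: f0_def)
    have uvw: "u \<noteq> v" "u \<noteq> w" "{u, w} \<in> edges G" using u v w AB' cross by auto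
    have f0: "embeds T G {p, r, q} f0"
      using distinct f0_simps uvw w u v AB' no by (auto simp: embeds_def insert_commute)
    have "connected_on T {p}" by (simp add: connected_on_def)
    then have "connected_on T {r, p}" using connected_on_insert pr by fastforce
    then have "connected_on T {q, r, p}" using connected_on_insert rq(3) by fastforce
    then have conn: "connected_on T {p, r, q}" by (simp add: insert_commute)
    obtain f where f: "embeds T G (vertices T) f" "\<And>x. x \<in> {p, r, q} \<Longrightarrow> f x = f0 x"
      by (rule tree_embedding_extend[OF tree simple deg _ _ conn f0])
        (use p q r1 VT in auto)
    have "u \<notin> f ` V1" "v \<notin> f ` V1"
      using avoid[OF f(1) p] avoid[OF f(1) q] f(2) f0_simps by simp_all
    then show thesis using that f(1) u v by blast
  qed
qed

text \<open>The criterion \<open>k_edge_connected_diameter_2\<close> applies with \<open>W\<close>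
  the image of \<open>V1\<close>: the vertices outside \<open>W\<close> still form a join after the
  deletion, and the degree bound pays for both \<open>W\<close> and the deleted edges.\<close>

lemma join_delete_tree:
  assumes simpleT: "simple_graph T" and deg_T: "1 \<le> max_degree T"
    and bip: "bipartition T V1 V2" and V1: "V1 \<noteq> {}"
    and simple: "simple_graph G" and deg: "k + max_degree T + card V1 - 1 \<le> min_degree G"
    and join: "join_parts G A B" and f: "embeds T G (vertices T) f"
    and AB: "A - f ` V1 \<noteq> {}" "B - f ` V1 \<noteq> {}"
  shows "k_edge_connected k (delete_edges G (edges (graph_image f T)))"
proof -
  have VT: "V1 \<union> V2 = vertices T" using bip by (auto simp: bipartition_def)
  have inj: "inj_on f (vertices T)" using f by (simp add: embeds_def)
  have fin1: "finite V1" using VT simple_graphD(1)[OF simpleT] by (metis finite_Un)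
  let ?F = "edges (graph_image f T)" and ?W = "f ` V1"
  let ?H = "delete_edges G ?F"
  have AB': "A \<inter> B = {}" "A \<union> B = vertices G" and cross: "\<And>a b. a \<in> A \<Longrightarrow> b \<in> B \<Longrightarrow> {a, b} \<in> edges G"
    using join by (auto simp: join_parts_def)
  have cardW: "card ?W \<le> card V1" using fin1 by (rule card_image_le)
  have nbr: "neighbours ?H v = neighbours G v - neighbours (graph_image f T) v" for v
    by (auto simp: neighbours_def delete_edges_def)
  have F: "x \<in> ?W \<or> y \<in> ?W" if xy: "{x, y} \<in> ?F" for x y
  proof -
    obtain e where e: "e \<in> edges T" "{x, y} = f ` e" using xy by (auto simp: graph_image_def)
    then obtain a b where "a \<in> V1" "e = {a, b}" using bip by (auto simp: bipartition_def)
    then show ?thesis using e by auto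
  qed
  have card2: "2 \<le> card (vertices G)"
  proof -
    obtain a b where "a \<in> A" "b \<in> B" using AB by blast
    moreover from this have "a \<noteq> b" using AB'(1) by blast
    ultimately have "{a, b} \<subseteq> vertices G" "card {a, b} = 2" using AB'(2) by auto
    then show ?thesis using simple_graphD(1)[OF simple] by (metis card_mono)
  qed
  show ?thesis
  proof (rule k_edge_connected_diameter_2[where W = ?W])
    show "simple_graph ?H" using simple by (rule simple_delete_edges)
    show "2 \<le> card (vertices ?H)" using card2 by (simp add: delete_edges_def)
  next
    fix v assume "v \<in> vertices ?H"
    then have v: "v \<in> vertices G" by (simp add: delete_edges_def)
    note dv = min_degree_le[OF simple v]
    show "k \<le> card (neighbours ?H v - ?W)"
    proof (cases "v \<in> ?W")
      case True
      then obtain x where x: "x \<in> V1" "v = f x" by blast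
      then have xT: "x \<in> vertices T" using VT by blast
      \<comment> \<open>All that \<open>v\<close> loses: its tree neighbours, at most
        \<open>max_degree T\<close>, and the other vertices of \<open>W\<close>. As \<open>v\<close>
        itself is not counted, this accounts for the -1 in the degree bound.\<close>
      define M where "M = neighbours (graph_image f T) v \<union> (?W - {v})"
      have nT: "neighbours (graph_image f T) v = f ` neighbours T x"
        using neighbours_graph_image[OF simpleT inj xT] x(2) by simp
      have finM: "finite M" using nT finite_neighbours[OF simpleT] fin1 by (simp add: M_def)
      have "card M \<le> card (f ` neighbours T x) + card (?W - {v})"
        unfolding M_def nT by (rule card_Un_le)
      moreover have "card (f ` neighbours T x) \<le> max_degree T"
        using card_image_le[OF finite_neighbours[OF simpleT]] max_degree_ge[OF simpleT xT]
        by (rule le_trans)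
      moreover have "card (?W - {v}) < card ?W"
        using True fin1 by (metis card_Diff1_less finite_imageI)
      moreover have "card (neighbours G v) - card M \<le> card (neighbours G v - M)"
        using finM by (rule diff_card_le_card_Diff)
      ultimately have "k \<le> card (neighbours G v - M)" using deg dv cardW by linarith
      moreover have "neighbours ?H v - ?W = neighbours G v - M"
        using nbr neighbours_subset[OF simple, of v] unfolding M_def by blast
      ultimately show ?thesis by simp
    next
      case False
      \<comment> \<open>Every tree edge meets \<open>W\<close>, so deleting the tree costs
        \<open>v\<close> no neighbour outside \<open>W\<close>.\<close>
      have "neighbours (graph_image f T) v \<subseteq> ?W"
        using F False by (auto simp: neighbours_def)
      then have "neighbours ?H v - ?W = neighbours G v - ?W" using nbr by blast
      then have eq: "card (neighbours ?H v - ?W) = card (neighbours G v - ?W)" by simp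
      have "card (neighbours G v) - card ?W \<le> card (neighbours G v - ?W)"
        using fin1 by (intro diff_card_le_card_Diff) simp
      \<comment> \<open>Here \<open>1 \<le> max_degree T\<close> absorbs the -1 in
        \<open>deg\<close>.\<close>
      then show ?thesis using deg deg_T dv cardW eq by linarith
    qed
  next
    fix u v
    assume "u \<in> vertices ?H - ?W" "v \<in> vertices ?H - ?W" "u \<noteq> v"
    then have uv: "u \<in> vertices G - ?W" "v \<in> vertices G - ?W" by (simp_all add: delete_edges_def)
    have E: "{x, y} \<in> edges ?H" "{y, x} \<in> edges ?H"
      if "x \<in> A - ?W" "y \<in> B - ?W" for x y
      using that cross F by (auto simp: delete_edges_def insert_commute)
    \<comment> \<open>Vertices in different parts are adjacent; two vertices of \<open>A\<close>
      share the neighbour \<open>b\<close>, two of \<open>B\<close> share \<open>a\<close>.\<close>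
    obtain a b where ab: "a \<in> A - ?W" "b \<in> B - ?W" using AB by blast
    have "u \<in> A - ?W \<or> u \<in> B - ?W" "v \<in> A - ?W \<or> v \<in> B - ?W" using uv AB'(2) by auto
    then show "{u, v} \<in> edges ?H \<or> (\<exists>z. {u, z} \<in> edges ?H \<and> {v, z} \<in> edges ?H)"
      using E ab by metis
  qed
qed

theorem theorem15:
  fixes k m :: nat and T :: "'a ugraph" and G :: "'b ugraph"
  assumes "k \<ge> 1" and "m \<ge> 1"
    and "tree T" and "graph_order T = m"
    and "cograph G" and "k_edge_connected k G"
    and "min_degree G \<ge> max (k + max_degree T + tree_beta T - 1) (m - 1)"
  shows "\<exists>T'. subtree T' G \<and> graph_iso T' T \<and> k_edge_connected k (delete_edges G (edges T'))"
proof -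
  have simpleT: "simple_graph T" and connT: "connected_graph T"
    using assms(3) by (auto simp: tree_def)
  have simple: "simple_graph G" using assms(5) by (rule cograph_simple_graph)
  obtain g where g: "g \<in> vertices G" using cograph_nonempty[OF assms(5)] by blast
  have deg: "k + max_degree T + tree_beta T - 1 \<le> min_degree G"
    "card (vertices T) - 1 \<le> min_degree G"
    using assms(4,7) by (auto simp: graph_order_def)
  have "\<exists>f. embeds T G (vertices T) f \<and> k_edge_connected k (delete_edges G (edges (graph_image f T)))"
  \<comment> \<open>A single vertex can be placed anywhere and deletes no edge. This case is
    separate because \<open>G\<close> may then itself have just one vertex and be no join.\<close>
  proof (cases "m = 1")
    case True
    then obtain t where t: "vertices T = {t}"
      using assms(4) by (auto simp: graph_order_def card_1_singleton_iff)
    have "edges T = {}"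
    proof (rule ccontr)
      assume "edges T \<noteq> {}"
      then obtain x y where "{x, y} \<in> edges T" using simple_graphD(4)[OF simpleT] by blast
      then have "x = t" "y = t" "x \<noteq> y" using simple_graphD(3)[OF simpleT, of x y] t by auto
      then show False by simp
    qed
    then have "embeds T G (vertices T) (\<lambda>_. g)" "edges (graph_image (\<lambda>_. g) T) = {}"
      using t g by (auto simp: embeds_def graph_image_def)
    moreover have "delete_edges G {} = G" by (simp add: delete_edges_def)
    ultimately show ?thesis using assms(6) by metis
  next
    case False
    obtain V1 V2 where V: "bipartition T V1 V2" "card V1 = tree_beta T" "card V1 \<le> card V2"
      using tree_betaE[OF assms(3)] False assms(4) by metis
    obtain t where t: "t \<in> vertices T" using connT by (auto simp: connected_graph_def)
    have "vertices T \<noteq> {t}" using False assms(4) by (auto simp: graph_order_def)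
    then obtain s where s: "{t, s} \<in> edges T"
      using boundary_edge[OF simpleT connT, of "{t}"] t by blast
    have V1: "V1 \<noteq> {}" using V(1) s by (auto simp: bipartition_def)
    have \<Delta>: "1 \<le> max_degree T"
    proof -
      have "neighbours T t \<noteq> {}" using s by (auto simp: neighbours_def)
      then have "card (neighbours T t) > 0"
        using finite_neighbours[OF simpleT] by (simp add: card_gt_0_iff)
      then show ?thesis using max_degree_ge[OF simpleT t] by simp
    qed
    \<comment> \<open>From \<open>m \<ge> 2\<close> and the bound \<open>m - 1\<close>. So
      \<open>G\<close> has more than one vertex and is genuinely connected.\<close>
    have "1 \<le> min_degree G" using deg assms(1,2,4) False by (simp add: graph_order_def)
    then have "graph_order G \<noteq> 1"
      using min_degree_less_order[OF simple g] by (simp add: graph_order_def)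
    then obtain A0 B0 where AB0: "join_parts G A0 B0"
      using connected_cograph_join[OF assms(5)] connected_if_k_edge_connected[OF assms(6,1)] by blast
    obtain A B where AB: "join_parts G A B" "card A \<le> card B"
      using AB0 join_parts_sym[OF AB0] by (meson nat_le_linear)
    \<comment> \<open>Strict because both \<open>k\<close> and \<open>max_degree T\<close> are at
      least 1.\<close>
    have "card V1 < min_degree G" using deg(1) V(2) \<Delta> assms(1) by linarith
    then obtain f where f: "embeds T G (vertices T) f" "A - f ` V1 \<noteq> {}" "B - f ` V1 \<noteq> {}"
      using tree_embedding_avoiding[OF assms(3) V(1,3) V1 simple deg(2) _ AB] by metis
    then show ?thesis
      using join_delete_tree[OF simpleT \<Delta> V(1) V1 simple _ AB(1) f(1)] deg(1) V(2) by auto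
  qed
  then show ?thesis
    using subtree_graph_image[OF assms(3)] graph_iso_image[OF simpleT] by (metis embeds_def)
qed

end
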